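(* Let $\pi\in\Gamma(\wedge^2T_{\mathbb C}M)$ be a complex Poisson bivector on a smooth manifold $M$ and let $E=\pi^\sharp(T^*_{\mathbb C}M)\subseteq T_{\mathbb C}M$. For each $p\in M$, the formula $$\widetilde\Omega_p(\pi^\sharp(\alpha),\pi^\sharp(\beta))=\pi(\alpha,\beta),\qquad \alpha,\beta\in T^*_{\mathbb C}M|_p,$$ gives a well-defined, skew-symmetric, non-degenerate $\mathbb C$-bilinear form on $E|_p$. Thus $\pi$ defines a family of complex symplectic vector spaces $\{(E|_p,\widetilde\Omega_p)\}_{p\in M}$.
   Context: $T_{\mathbb C}M=TM\otimes\mathbb C$, $T^*_{\mathbb C}M=T^*M\otimes\mathbb C$. A complex Poisson bivector is a section $\pi$ of $\wedge^2T_{\mathbb C}M$ with $[\pi,\pi]=0$ for the complexified Schouten bracket; $\pi^\sharp:T^*_{\mathbb C}M\to T_{\mathbb C}M$ is the induced bundle map, $\pi(\alpha,\beta)=\beta(\pi^\sharp\alpha)$. *)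

theory Defs
  imports
    "HOL-Analysis.Analysis"
    "HOL-Library.Function_Algebras"
    "HOL-Combinatorics.Permutations"
begin

section \<open>Smooth manifolds\<close>

text \<open>
  The model space is the library's \<open>Euclidean_space n\<close>, whose points are the sequences
  \<open>x :: nat \<Rightarrow> real\<close> with \<open>x i = 0\<close> for \<open>i \<ge> n\<close>; the coordinates are those of index \<open>i < n\<close>.
  In \<open>Ck_on n U k f\<close> the set \<open>U\<close> is meant to be open in \<open>Euclidean_space n\<close>.
\<close>

primrec Ck_on ::
  "nat \<Rightarrow> (nat \<Rightarrow> real) set \<Rightarrow> nat \<Rightarrow> ((nat \<Rightarrow> real) \<Rightarrow> 'b::real_normed_vector) \<Rightarrow> bool" where
  "Ck_on n U 0 f \<longleftrightarrow> continuous_on U f"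
| "Ck_on n U (Suc k) f \<longleftrightarrow> continuous_on U f \<and>
     (\<forall>i<n. \<exists>g. (\<forall>x\<in>U. ((\<lambda>t. f (x(i := t))) has_vector_derivative g x) (at (x i))) \<and>
                Ck_on n U k g)"

definition smooth_on ::
  "nat \<Rightarrow> (nat \<Rightarrow> real) set \<Rightarrow> ((nat \<Rightarrow> real) \<Rightarrow> 'b::real_normed_vector) \<Rightarrow> bool" where
  "smooth_on n U f \<longleftrightarrow> (\<forall>k. Ck_on n U k f)"

type_synonym 'a chart = "'a set \<times> ('a \<Rightarrow> nat \<Rightarrow> real)"

text \<open>
  A smooth manifold of dimension \<open>n\<close> is a Hausdorff, second countable space \<open>M\<close> with a smooth
  atlas \<open>A\<close>. The atlas need not be maximal: every notion below depends only on the smooth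
  structure that it generates.
\<close>

definition smooth_manifold :: "nat \<Rightarrow> 'a topology \<Rightarrow> 'a chart set \<Rightarrow> bool" where
  "smooth_manifold n M A \<longleftrightarrow>
     Hausdorff_space M \<and> second_countable M \<and>
     (\<forall>(U, \<phi>)\<in>A. openin M U \<and> openin (Euclidean_space n) (\<phi> ` U) \<and>
        homeomorphic_map (subtopology M U) (subtopology (Euclidean_space n) (\<phi> ` U)) \<phi>) \<and>
     (\<Union>(U, \<phi>)\<in>A. U) = topspace M \<and>
     (\<forall>(U, \<phi>)\<in>A. \<forall>(V, \<psi>)\<in>A. \<forall>j<n.
        smooth_on n (\<phi> ` (U \<inter> V)) (\<lambda>x. \<psi> (inv_into U \<phi> x) j))"

text \<open>
  Functions on \<open>M\<close>, tangent vectors, covectors and forms are all total functions in HOL. They are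
  normalised to be \<open>0\<close> outside their proper domain, so that equality is equality on that domain
  and the vector space operations are the pointwise ones.
\<close>

definition smooth_functions ::
  "nat \<Rightarrow> 'a topology \<Rightarrow> 'a chart set \<Rightarrow> ('a \<Rightarrow> 'b::real_normed_vector) set" where
  "smooth_functions n M A =
     {f. (\<forall>x. x \<notin> topspace M \<longrightarrow> f x = 0) \<and>
         (\<forall>(U, \<phi>)\<in>A. smooth_on n (\<phi> ` U) (f \<circ> inv_into U \<phi>))}"


section \<open>Tangent and cotangent spaces and their complexifications\<close>

text \<open>Tangent vectors at \<open>p\<close> are the derivations at \<open>p\<close> of the algebra of smooth real functions.\<close>

definition tangent_space ::
  "nat \<Rightarrow> 'a topology \<Rightarrow> 'a chart set \<Rightarrow> 'a \<Rightarrow> (('a \<Rightarrow> real) \<Rightarrow> real) set" where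
  "tangent_space n M A p =
     {X. (\<forall>f. f \<notin> smooth_functions n M A \<longrightarrow> X f = 0) \<and>
         (\<forall>f\<in>smooth_functions n M A. \<forall>g\<in>smooth_functions n M A.
            (\<forall>a b. X (\<lambda>x. a * f x + b * g x) = a * X f + b * X g) \<and>
            X (\<lambda>x. f x * g x) = f p * X g + g p * X f)}"

definition cotangent_space ::
  "nat \<Rightarrow> 'a topology \<Rightarrow> 'a chart set \<Rightarrow> 'a \<Rightarrow> ((('a \<Rightarrow> real) \<Rightarrow> real) \<Rightarrow> real) set" where
  "cotangent_space n M A p =
     {\<xi>. (\<forall>X. X \<notin> tangent_space n M A p \<longrightarrow> \<xi> X = 0) \<and>
         (\<forall>X\<in>tangent_space n M A p. \<forall>Y\<in>tangent_space n M A p. \<forall>a b.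
            \<xi> (\<lambda>f. a * X f + b * Y f) = a * \<xi> X + b * \<xi> Y)}"

text \<open>
  For a real vector space \<open>V\<close> of real-valued functions, \<open>V \<otimes> \<complex>\<close> is realised as the complex vector
  space of all complex-valued functions \<open>a + \<i> b\<close> with \<open>a, b \<in> V\<close>.
\<close>

definition complexification :: "('b \<Rightarrow> real) set \<Rightarrow> ('b \<Rightarrow> complex) set" where
  "complexification V = {\<lambda>x. complex_of_real (a x) + \<i> * complex_of_real (b x) | a b. a \<in> V \<and> b \<in> V}"

abbreviation complex_tangent_space ::
  "nat \<Rightarrow> 'a topology \<Rightarrow> 'a chart set \<Rightarrow> 'a \<Rightarrow> (('a \<Rightarrow> real) \<Rightarrow> complex) set" where
  "complex_tangent_space n M A p \<equiv> complexification (tangent_space n M A p)"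

abbreviation complex_cotangent_space ::
  "nat \<Rightarrow> 'a topology \<Rightarrow> 'a chart set \<Rightarrow> 'a \<Rightarrow> ((('a \<Rightarrow> real) \<Rightarrow> real) \<Rightarrow> complex) set" where
  "complex_cotangent_space n M A p \<equiv> complexification (cotangent_space n M A p)"

text \<open>
  The \<open>\<complex>\<close>-bilinear extension of the evaluation of covectors on tangent vectors:
  \<open>\<alpha> (X + \<i> Y) = \<alpha> X + \<i> \<alpha> Y\<close>.
\<close>

definition pairing ::
  "((('a \<Rightarrow> real) \<Rightarrow> real) \<Rightarrow> complex) \<Rightarrow> (('a \<Rightarrow> real) \<Rightarrow> complex) \<Rightarrow> complex" where
  "pairing \<alpha> v = \<alpha> (\<lambda>f. Re (v f)) + \<i> * \<alpha> (\<lambda>f. Im (v f))"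

definition differential ::
  "nat \<Rightarrow> 'a topology \<Rightarrow> 'a chart set \<Rightarrow> ('a \<Rightarrow> complex) \<Rightarrow> 'a \<Rightarrow>
     (('a \<Rightarrow> real) \<Rightarrow> real) \<Rightarrow> complex" where
  "differential n M A f p X =
     (if X \<in> tangent_space n M A p then Complex (X (\<lambda>x. Re (f x))) (X (\<lambda>x. Im (f x))) else 0)"

definition coordinate_vector ::
  "nat \<Rightarrow> 'a topology \<Rightarrow> 'a chart set \<Rightarrow> 'a chart \<Rightarrow> nat \<Rightarrow> 'a \<Rightarrow> ('a \<Rightarrow> real) \<Rightarrow> real" where
  "coordinate_vector n M A = (\<lambda>(U, \<phi>) i p f.
     if f \<in> smooth_functions n M A
     then vector_derivative (\<lambda>t. f (inv_into U \<phi> ((\<phi> p)(i := t)))) (at (\<phi> p i)) else 0)"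


section \<open>Complex bivectors\<close>

text \<open>
  An element of \<open>\<And>\<^sup>2 V\<close> is represented by the bilinear form that it induces on the dual of \<open>V\<close>, with
  \<open>(u \<and> v)(\<alpha>, \<beta>) = \<alpha>(u) \<beta>(v) - \<alpha>(v) \<beta>(u)\<close>; so \<open>\<And>\<^sup>2 V\<close> consists of the finite sums of such \<open>u \<and> v\<close>.
\<close>

type_synonym 'a bivector =
  "((('a \<Rightarrow> real) \<Rightarrow> real) \<Rightarrow> complex) \<Rightarrow> ((('a \<Rightarrow> real) \<Rightarrow> real) \<Rightarrow> complex) \<Rightarrow> complex"

definition wedge ::
  "nat \<Rightarrow> 'a topology \<Rightarrow> 'a chart set \<Rightarrow> 'a \<Rightarrow>
     (('a \<Rightarrow> real) \<Rightarrow> complex) \<Rightarrow> (('a \<Rightarrow> real) \<Rightarrow> complex) \<Rightarrow> 'a bivector" where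
  "wedge n M A p u v = (\<lambda>\<alpha> \<beta>.
     if \<alpha> \<in> complex_cotangent_space n M A p \<and> \<beta> \<in> complex_cotangent_space n M A p
     then pairing \<alpha> u * pairing \<beta> v - pairing \<alpha> v * pairing \<beta> u else 0)"

definition bivectors :: "nat \<Rightarrow> 'a topology \<Rightarrow> 'a chart set \<Rightarrow> 'a \<Rightarrow> 'a bivector set" where
  "bivectors n M A p =
     {\<lambda>\<alpha> \<beta>. \<Sum>(u, v)\<leftarrow>uvs. wedge n M A p u v \<alpha> \<beta> | uvs.
        set uvs \<subseteq> complex_tangent_space n M A p \<times> complex_tangent_space n M A p}"

text \<open>
  Smooth sections of \<open>\<And>\<^sup>2 T\<^sub>\<complex> M\<close>: in every chart of the atlas, smooth complex coefficients
  with respect to the \<open>\<partial>\<^sub>i \<and> \<partial>\<^sub>j\<close>. Values of \<open>\<pi>\<close> outside \<open>topspace M\<close> are irrelevant.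
\<close>

definition bivector_field ::
  "nat \<Rightarrow> 'a topology \<Rightarrow> 'a chart set \<Rightarrow> ('a \<Rightarrow> 'a bivector) \<Rightarrow> bool" where
  "bivector_field n M A \<pi> \<longleftrightarrow>
     (\<forall>p\<in>topspace M. \<pi> p \<in> bivectors n M A p) \<and>
     (\<forall>(U, \<phi>)\<in>A. \<exists>c. (\<forall>i<n. \<forall>j<n. smooth_on n (\<phi> ` U) (c i j)) \<and>
        (\<forall>p\<in>U. \<forall>\<alpha> \<beta>. \<pi> p \<alpha> \<beta> =
           (\<Sum>i<n. \<Sum>j<n. c i j (\<phi> p) *
              wedge n M A p
                (\<lambda>f. complex_of_real (coordinate_vector n M A (U, \<phi>) i p f))
                (\<lambda>f. complex_of_real (coordinate_vector n M A (U, \<phi>) j p f)) \<alpha> \<beta>)))"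

text \<open>
  The Schouten bracket of multivector fields, which are identified with the skew-symmetric
  multiderivations of the algebra of smooth complex functions (\<open>\<complex>\<close>-multilinear in all arguments, so
  this is the complexified bracket). For \<open>P\<close> of degree \<open>p\<close> and \<open>Q\<close> of degree \<open>q\<close>,
  \<open>[P, Q] = P \<circ> Q - (-1)\<^bsup>(p-1)(q-1)\<^esup> Q \<circ> P\<close>, where
  \<open>P \<circ> Q\<close> inserts \<open>Q\<close> into the first argument of \<open>P\<close>: it maps \<open>f\<close> to the sum of
  \<open>sgn \<sigma> \<cdot> P(Q(f (\<sigma> 1), \<dots>, f (\<sigma> q)), f (\<sigma> (q + 1)), \<dots>)\<close> over the \<open>(q, p - 1)\<close>-shuffles \<open>\<sigma>\<close>.
  A bivector \<open>\<pi>\<close> acts as the biderivation \<open>(f, g) \<mapsto> \<pi>(df, dg)\<close>.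
\<close>

definition shuffle_perms :: "nat \<Rightarrow> nat \<Rightarrow> (nat \<Rightarrow> nat) set" where
  "shuffle_perms q r =
     {\<sigma>. \<sigma> permutes {..<q + r} \<and> strict_mono_on {..<q} \<sigma> \<and> strict_mono_on {q..<q + r} \<sigma>}"

definition insertion ::
  "nat \<Rightarrow> nat \<Rightarrow> (('a \<Rightarrow> complex) list \<Rightarrow> 'a \<Rightarrow> complex) \<Rightarrow> (('a \<Rightarrow> complex) list \<Rightarrow> 'a \<Rightarrow> complex) \<Rightarrow>
     ('a \<Rightarrow> complex) list \<Rightarrow> 'a \<Rightarrow> complex" where
  "insertion p q P Q fs x =
     (\<Sum>\<sigma>\<in>shuffle_perms q (p - 1). of_int (sign \<sigma>) *
        P (Q (map (\<lambda>i. fs ! \<sigma> i) [0..<q]) # map (\<lambda>i. fs ! \<sigma> i) [q..<q + (p - 1)]) x)"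

definition schouten ::
  "nat \<Rightarrow> nat \<Rightarrow> (('a \<Rightarrow> complex) list \<Rightarrow> 'a \<Rightarrow> complex) \<Rightarrow> (('a \<Rightarrow> complex) list \<Rightarrow> 'a \<Rightarrow> complex) \<Rightarrow>
     ('a \<Rightarrow> complex) list \<Rightarrow> 'a \<Rightarrow> complex" where
  "schouten p q P Q fs x =
     insertion p q P Q fs x - (-1) ^ ((p - 1) * (q - 1)) * insertion q p Q P fs x"

definition biderivation ::
  "nat \<Rightarrow> 'a topology \<Rightarrow> 'a chart set \<Rightarrow> ('a \<Rightarrow> 'a bivector) \<Rightarrow>
     ('a \<Rightarrow> complex) list \<Rightarrow> 'a \<Rightarrow> complex" where
  "biderivation n M A \<pi> fs x =
     (if x \<in> topspace M
      then \<pi> x (differential n M A (fs ! 0) x) (differential n M A (fs ! 1) x) else 0)"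

definition complex_poisson_bivector ::
  "nat \<Rightarrow> 'a topology \<Rightarrow> 'a chart set \<Rightarrow> ('a \<Rightarrow> 'a bivector) \<Rightarrow> bool" where
  "complex_poisson_bivector n M A \<pi> \<longleftrightarrow>
     bivector_field n M A \<pi> \<and>
     (\<forall>f\<in>smooth_functions n M A. \<forall>g\<in>smooth_functions n M A. \<forall>h\<in>smooth_functions n M A.
        \<forall>x\<in>topspace M.
          schouten 2 2 (biderivation n M A \<pi>) (biderivation n M A \<pi>) [f, g, h] x = 0)"

definition sharp ::
  "nat \<Rightarrow> 'a topology \<Rightarrow> 'a chart set \<Rightarrow> ('a \<Rightarrow> 'a bivector) \<Rightarrow> 'a \<Rightarrow>
     ((('a \<Rightarrow> real) \<Rightarrow> real) \<Rightarrow> complex) \<Rightarrow> ('a \<Rightarrow> real) \<Rightarrow> complex" where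
  "sharp n M A \<pi> p \<alpha> =
     (THE v. v \<in> complex_tangent_space n M A p \<and>
             (\<forall>\<beta>\<in>complex_cotangent_space n M A p. \<pi> p \<alpha> \<beta> = pairing \<beta> v))"

definition sharp_image ::
  "nat \<Rightarrow> 'a topology \<Rightarrow> 'a chart set \<Rightarrow> ('a \<Rightarrow> 'a bivector) \<Rightarrow> 'a \<Rightarrow>
     (('a \<Rightarrow> real) \<Rightarrow> complex) set" where
  "sharp_image n M A \<pi> p = sharp n M A \<pi> p ` complex_cotangent_space n M A p"


section \<open>Complex symplectic vector spaces\<close>

interpretation cfun: vector_space "\<lambda>(c::complex) (v :: 'b \<Rightarrow> complex) x. c * v x"
  by unfold_locales (auto simp: fun_eq_iff algebra_simps)

definition complex_symplectic_space ::
  "('b \<Rightarrow> complex) set \<Rightarrow> (('b \<Rightarrow> complex) \<Rightarrow> ('b \<Rightarrow> complex) \<Rightarrow> complex) \<Rightarrow> bool" where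
  "complex_symplectic_space V \<omega> \<longleftrightarrow>
     cfun.subspace V \<and> (\<exists>B. finite B \<and> V = cfun.span B) \<and>
     (\<forall>u\<in>V. \<forall>v\<in>V. \<forall>w\<in>V. \<forall>a b.
        \<omega> (\<lambda>x. a * u x + b * v x) w = a * \<omega> u w + b * \<omega> v w \<and>
        \<omega> w (\<lambda>x. a * u x + b * v x) = a * \<omega> w u + b * \<omega> w v) \<and>
     (\<forall>u\<in>V. \<forall>v\<in>V. \<omega> u v = - \<omega> v u) \<and>
     (\<forall>u\<in>V. (\<forall>v\<in>V. \<omega> u v = 0) \<longrightarrow> u = 0)"

text \<open>
  \<open>\<Omega>\<close> is a form on \<open>E\<^sub>p\<close> given by \<open>\<Omega>(\<pi>\<^sup>\<sharp> \<alpha>, \<pi>\<^sup>\<sharp> \<beta>) = \<pi>(\<alpha>, \<beta>)\<close>; that this formula is well defined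
  is the existence of exactly one such \<open>\<Omega>\<close>.
\<close>

definition form_given_by ::
  "nat \<Rightarrow> 'a topology \<Rightarrow> 'a chart set \<Rightarrow> ('a \<Rightarrow> 'a bivector) \<Rightarrow> 'a \<Rightarrow>
     ((('a \<Rightarrow> real) \<Rightarrow> complex) \<Rightarrow> (('a \<Rightarrow> real) \<Rightarrow> complex) \<Rightarrow> complex) \<Rightarrow> bool" where
  "form_given_by n M A \<pi> p \<Omega> \<longleftrightarrow>
     (\<forall>u v. u \<notin> sharp_image n M A \<pi> p \<or> v \<notin> sharp_image n M A \<pi> p \<longrightarrow> \<Omega> u v = 0) \<and>
     (\<forall>\<alpha>\<in>complex_cotangent_space n M A p. \<forall>\<beta>\<in>complex_cotangent_space n M A p.
        \<Omega> (sharp n M A \<pi> p \<alpha>) (sharp n M A \<pi> p \<beta>) = \<pi> p \<alpha> \<beta>)"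

end

theory Submission
  imports Defs
begin

text \<open>
  A bivector is skew, and contracting a finite sum of \<open>u \<and> v\<close> with \<open>\<alpha>\<close> gives a vector that
  represents \<open>\<pi>(\<alpha>, \<cdot>)\<close>. Covectors separate tangent vectors, because the differentials \<open>X \<mapsto> X f\<close>
  do, so this vector is unique and is \<open>\<pi>\<^sup>\<sharp> \<alpha>\<close>; no local coordinates are needed. Hence
  \<open>\<pi>(\<alpha>, \<beta>) = \<beta>(\<pi>\<^sup>\<sharp> \<alpha>) = - \<alpha>(\<pi>\<^sup>\<sharp> \<beta>)\<close> depends only on \<open>\<pi>\<^sup>\<sharp> \<alpha>\<close> and \<open>\<pi>\<^sup>\<sharp> \<beta>\<close>, and a vector \<open>\<pi>\<^sup>\<sharp> \<alpha>\<close> in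
  the radical is annihilated by all covectors.
\<close>

section \<open>Complexification: complex subspaces from real ones\<close>

lemma complexification_iff:
  "v \<in> complexification V \<longleftrightarrow> (\<lambda>x. Re (v x)) \<in> V \<and> (\<lambda>x. Im (v x)) \<in> V"
proof
  assume "v \<in> complexification V"
  then show "(\<lambda>x. Re (v x)) \<in> V \<and> (\<lambda>x. Im (v x)) \<in> V"
    by (auto simp: complexification_def)
next
  assume "(\<lambda>x. Re (v x)) \<in> V \<and> (\<lambda>x. Im (v x)) \<in> V"
  moreover have "v = (\<lambda>x. complex_of_real (Re (v x)) + \<i> * complex_of_real (Im (v x)))"
    by (simp add: fun_eq_iff complex_eq[symmetric])
  ultimately show "v \<in> complexification V"
    unfolding complexification_def
    by (intro CollectI exI[of _ "\<lambda>x. Re (v x)"] exI[of _ "\<lambda>x. Im (v x)"]) simp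
qed

lemma subspace_complexification:
  assumes zero: "(\<lambda>x. 0) \<in> V"
    and lin: "\<And>X Y a b. X \<in> V \<Longrightarrow> Y \<in> V \<Longrightarrow> (\<lambda>x. a * X x + b * Y x) \<in> V"
  shows "cfun.subspace (complexification V)"
proof (rule cfun.subspaceI)
  show "0 \<in> complexification V"
    using zero by (simp add: complexification_iff)
next
  fix u v assume "u \<in> complexification V" "v \<in> complexification V"
  then show "u + v \<in> complexification V"
    using lin[of "\<lambda>x. Re (u x)" "\<lambda>x. Re (v x)" 1 1] lin[of "\<lambda>x. Im (u x)" "\<lambda>x. Im (v x)" 1 1]
    by (simp add: complexification_iff)
next
  \<comment> \<open>The real and imaginary parts of \<open>c * v\<close> are the real combinations
    \<open>Re c * Re v - Im c * Im v\<close> and \<open>Re c * Im v + Im c * Re v\<close>.\<close>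
  fix c v assume "v \<in> complexification V"
  then show "(\<lambda>x. c * v x) \<in> complexification V"
    using lin[of "\<lambda>x. Re (v x)" "\<lambda>x. Im (v x)" "Re c" "- Im c"]
      lin[of "\<lambda>x. Im (v x)" "\<lambda>x. Re (v x)" "Re c" "Im c"]
    by (simp add: complexification_iff)
qed

lemma tangent_space_zero: "(\<lambda>f. 0) \<in> tangent_space n M A p"
  by (simp add: tangent_space_def)

lemma tangent_space_lincomb:
  assumes "X \<in> tangent_space n M A p" "Y \<in> tangent_space n M A p"
  shows "(\<lambda>f. a * X f + b * Y f) \<in> tangent_space n M A p"
  using assms by (simp add: tangent_space_def algebra_simps)

lemma cotangent_space_zero: "(\<lambda>X. 0) \<in> cotangent_space n M A p"
  by (simp add: cotangent_space_def)

lemma cotangent_space_lincomb: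
  assumes "\<xi> \<in> cotangent_space n M A p" "\<eta> \<in> cotangent_space n M A p"
  shows "(\<lambda>X. a * \<xi> X + b * \<eta> X) \<in> cotangent_space n M A p"
  using assms by (simp add: cotangent_space_def algebra_simps)

lemma subspace_complex_tangent_space: "cfun.subspace (complex_tangent_space n M A p)"
  by (intro subspace_complexification tangent_space_zero tangent_space_lincomb)

lemma subspace_complex_cotangent_space: "cfun.subspace (complex_cotangent_space n M A p)"
  by (intro subspace_complexification cotangent_space_zero cotangent_space_lincomb)

section \<open>The complex-bilinear pairing\<close>

lemma complex_covector_lincomb:
  assumes "\<alpha> \<in> complex_cotangent_space n M A p"
    and "X \<in> tangent_space n M A p" "Y \<in> tangent_space n M A p"
  shows "\<alpha> (\<lambda>f. a * X f + b * Y f) = of_real a * \<alpha> X + of_real b * \<alpha> Y"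
  using assms by (simp add: complexification_iff cotangent_space_def complex_eq_iff)

lemma pairing_add_right:
  assumes "\<alpha> \<in> complex_cotangent_space n M A p"
    and "u \<in> complex_tangent_space n M A p" "v \<in> complex_tangent_space n M A p"
  shows "pairing \<alpha> (u + v) = pairing \<alpha> u + pairing \<alpha> v"
  using assms(2,3)
    complex_covector_lincomb[OF assms(1), of "\<lambda>f. Re (u f)" "\<lambda>f. Re (v f)" 1 1]
    complex_covector_lincomb[OF assms(1), of "\<lambda>f. Im (u f)" "\<lambda>f. Im (v f)" 1 1]
  by (simp add: complexification_iff pairing_def algebra_simps)

lemma pairing_scale_right:
  assumes "\<alpha> \<in> complex_cotangent_space n M A p" and "v \<in> complex_tangent_space n M A p"
  shows "pairing \<alpha> (\<lambda>f. c * v f) = c * pairing \<alpha> v"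
proof -
  \<comment> \<open>Splitting \<open>c\<close> reduces complex homogeneity to real linearity of
    \<alpha> on the real and imaginary parts of \<open>v\<close>, which are real tangent
    vectors.\<close>
  have "pairing \<alpha> (\<lambda>f. c * v f) = Complex (Re c) (Im c) * pairing \<alpha> v"
    using assms(2)
      complex_covector_lincomb[OF assms(1), of "\<lambda>f. Re (v f)" "\<lambda>f. Im (v f)" "Re c" "- Im c"]
      complex_covector_lincomb[OF assms(1), of "\<lambda>f. Im (v f)" "\<lambda>f. Re (v f)" "Re c" "Im c"]
    by (simp add: complexification_iff pairing_def Complex_eq algebra_simps)
  then show ?thesis by simp
qed

lemma pairing_zero_right:
  assumes "\<alpha> \<in> complex_cotangent_space n M A p"
  shows "pairing \<alpha> 0 = 0"
  using pairing_scale_right[OF assms cfun.subspace_0[OF subspace_complex_tangent_space], of 0]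
  by (simp add: zero_fun_def)

lemma pairing_separates:
  assumes u: "u \<in> complex_tangent_space n M A p" and v: "v \<in> complex_tangent_space n M A p"
    and eq: "\<And>\<beta>. \<beta> \<in> complex_cotangent_space n M A p \<Longrightarrow> pairing \<beta> u = pairing \<beta> v"
  shows "u = v"
proof
  fix f
  \<comment> \<open>For the fixed \<open>f\<close> this is the covector \<open>df\<close>. It is a
    real covector because tangent vectors are combined pointwise; the default 0 is the normalisation
    of \<open>cotangent_space\<close>. Pairing it with \<open>u\<close> returns
    \<open>u f\<close>.\<close>
  define \<beta> :: "(('a \<Rightarrow> real) \<Rightarrow> real) \<Rightarrow> complex"
    where "\<beta> X = (if X \<in> tangent_space n M A p then of_real (X f) else 0)" for X
  have "\<beta> \<in> complex_cotangent_space n M A p"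
    using tangent_space_lincomb[of _ n M A p]
    by (simp add: complexification_iff cotangent_space_def \<beta>_def)
  from eq[OF this] show "u f = v f"
    using u v by (simp add: complexification_iff pairing_def \<beta>_def complex_eq_iff)
qed

section \<open>Bivectors: skewness and contraction\<close>

lemma bivectorsE:
  assumes "P \<in> bivectors n M A p"
  obtains uvs where "P = (\<lambda>\<alpha> \<beta>. \<Sum>(u, v)\<leftarrow>uvs. wedge n M A p u v \<alpha> \<beta>)"
    and "set uvs \<subseteq> complex_tangent_space n M A p \<times> complex_tangent_space n M A p"
  using assms unfolding bivectors_def by blast

text \<open>Each wedge is skew. This includes arguments that are not complex covectors, since the
  guard in \<open>wedge\<close> is symmetric in \<alpha> and \<beta>.\<close>

lemma bivector_skew:
  assumes "P \<in> bivectors n M A p"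
  shows "P \<alpha> \<beta> = - P \<beta> \<alpha>"
proof -
  obtain uvs where P: "P = (\<lambda>\<alpha> \<beta>. \<Sum>(u, v)\<leftarrow>uvs. wedge n M A p u v \<alpha> \<beta>)"
    using assms by (rule bivectorsE)
  show ?thesis
    unfolding P by (induction uvs) (auto simp: wedge_def)
qed

text \<open>Contracting \<open>u\<close> wedge \<open>v\<close> with \<alpha> gives \<alpha>(u) v -
  \<alpha>(v) u, which lies in the span of \<open>u\<close> and \<open>v\<close>. The set
  \<open>B\<close> is chosen before \<alpha>, so the same lemma yields both the existence of the
  sharp vector and a finite bound on the dimension of its image.\<close>

lemma bivector_contraction:
  assumes "P \<in> bivectors n M A p"
  obtains B where "finite B" "B \<subseteq> complex_tangent_space n M A p"
    "\<And>\<alpha>. \<alpha> \<in> complex_cotangent_space n M A p \<Longrightarrow>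
       \<exists>v\<in>cfun.span B. \<forall>\<beta>\<in>complex_cotangent_space n M A p. P \<alpha> \<beta> = pairing \<beta> v"
proof -
  let ?T = "complex_tangent_space n M A p" and ?C = "complex_cotangent_space n M A p"
  obtain uvs where P: "P = (\<lambda>\<alpha> \<beta>. \<Sum>(u, v)\<leftarrow>uvs. wedge n M A p u v \<alpha> \<beta>)"
    and uvs: "set uvs \<subseteq> ?T \<times> ?T"
    using assms by (rule bivectorsE)
  define B where "B = fst ` set uvs \<union> snd ` set uvs"
  have BT: "B \<subseteq> ?T"
    using uvs by (auto simp: B_def)
  have spanT: "cfun.span B \<subseteq> ?T"
    by (rule cfun.span_minimal[OF BT subspace_complex_tangent_space])
  \<comment> \<open>The induction runs over lists \<open>ws\<close> with entries from
    \<open>uvs\<close>, so that \<open>B\<close> stays fixed while the list shrinks.\<close>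
  have "\<exists>w\<in>cfun.span B. \<forall>\<beta>\<in>?C. (\<Sum>(u, v)\<leftarrow>ws. wedge n M A p u v \<alpha> \<beta>) = pairing \<beta> w"
    if \<alpha>: "\<alpha> \<in> ?C" and "set ws \<subseteq> set uvs" for \<alpha> ws
    using that(2)
  proof (induction ws)
    case Nil
    show ?case
      by (rule bexI[OF _ cfun.span_zero])
        (simp add: pairing_zero_right[unfolded zero_fun_def] zero_fun_def)
  next
    case (Cons uv ws)
    obtain u v where uv: "uv = (u, v)" by (cases uv)
    have "u \<in> B" "v \<in> B"
      using Cons.prems unfolding uv B_def by force+
    then have uB: "u \<in> cfun.span B" and vB: "v \<in> cfun.span B"
      by (auto intro: cfun.span_base)
    obtain w where w: "w \<in> cfun.span B"
      "\<And>\<beta>. \<beta> \<in> ?C \<Longrightarrow> (\<Sum>(u, v)\<leftarrow>ws. wedge n M A p u v \<alpha> \<beta>) = pairing \<beta> w"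
      using Cons by auto
    \<comment> \<open>\<open>r + s\<close> is the contraction of the head of the list with \<alpha>;
      \<open>w\<close> is that of the tail.\<close>
    define r where "r = (\<lambda>f. pairing \<alpha> u * v f)"
    define s where "s = (\<lambda>f. - pairing \<alpha> v * u f)"
    have r: "r \<in> cfun.span B" and s: "s \<in> cfun.span B"
      unfolding r_def s_def by (rule cfun.span_scale[OF vB] cfun.span_scale[OF uB])+
    then have rs: "r + s \<in> cfun.span B" and rsw: "r + s + w \<in> cfun.span B"
      using w(1) by (auto intro: cfun.span_add)
    have eq: "(\<Sum>(u, v)\<leftarrow>uv # ws. wedge n M A p u v \<alpha> \<beta>) = pairing \<beta> (r + s + w)"
      if \<beta>: "\<beta> \<in> ?C" for \<beta>
    proof -
      have "pairing \<beta> (r + s + w) = pairing \<beta> r + pairing \<beta> s + pairing \<beta> w"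
        using \<beta> r s rs w(1) spanT by (simp add: pairing_add_right subset_iff)
      moreover have "pairing \<beta> r = pairing \<alpha> u * pairing \<beta> v"
        unfolding r_def using \<beta> vB spanT by (intro pairing_scale_right) auto
      moreover have "pairing \<beta> s = - pairing \<alpha> v * pairing \<beta> u"
        unfolding s_def using \<beta> uB spanT by (intro pairing_scale_right) auto
      ultimately show ?thesis
        using \<alpha> \<beta> w(2) by (simp add: uv wedge_def)
    qed
    show ?case
      by (rule bexI[OF ballI rsw]) (rule eq)
  qed
  with BT show ?thesis
    by (intro that[of B]) (auto simp: P B_def)
qed

text \<open>A basis of \<open>V\<close> is an independent set inside the span of the finite set
  \<open>B\<close>, hence finite by the exchange argument. It serves to find a finite spanning set
  inside E itself.\<close>

lemma (in vector_space) subspace_of_finite_span: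
  assumes "subspace V" "finite B" "V \<subseteq> span B"
  shows "\<exists>C. finite C \<and> V = span C"
proof -
  obtain C where C: "C \<subseteq> V" "independent C" "V \<subseteq> span C"
    using basis_exists[of V] by metis
  have "finite C"
    using independent_span_bound[OF assms(2) C(2)] C(1) assms(3) by blast
  moreover have "span C \<subseteq> V"
    by (rule span_minimal[OF C(1) assms(1)])
  ultimately show ?thesis
    using C(3) by blast
qed

section \<open>The sharp map at a fixed point\<close>

locale bivector_at =
  fixes n :: nat and M :: "'a topology" and A :: "'a chart set"
    and \<pi> :: "'a \<Rightarrow> 'a bivector" and p :: 'a
  assumes P: "\<pi> p \<in> bivectors n M A p"
begin

text \<open>This justifies the definite description in \<open>sharp\<close>: existence comes from
  contraction, uniqueness from the separation of vectors by covectors.\<close>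

lemma sharp_exists_unique:
  assumes \<alpha>: "\<alpha> \<in> complex_cotangent_space n M A p"
  shows "\<exists>!v. v \<in> complex_tangent_space n M A p \<and>
           (\<forall>\<beta>\<in>complex_cotangent_space n M A p. \<pi> p \<alpha> \<beta> = pairing \<beta> v)"
proof (rule ex_ex1I)
  obtain B where "B \<subseteq> complex_tangent_space n M A p"
    and *: "\<And>\<alpha>. \<alpha> \<in> complex_cotangent_space n M A p \<Longrightarrow>
       \<exists>v\<in>cfun.span B. \<forall>\<beta>\<in>complex_cotangent_space n M A p. \<pi> p \<alpha> \<beta> = pairing \<beta> v"
    by (rule bivector_contraction[OF P]) blast
  then have "cfun.span B \<subseteq> complex_tangent_space n M A p"
    by (intro cfun.span_minimal subspace_complex_tangent_space)
  with *[OF \<alpha>] show "\<exists>v. v \<in> complex_tangent_space n M A p \<and>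
           (\<forall>\<beta>\<in>complex_cotangent_space n M A p. \<pi> p \<alpha> \<beta> = pairing \<beta> v)"
    by blast
next
  fix u v
  assume "u \<in> complex_tangent_space n M A p \<and>
           (\<forall>\<beta>\<in>complex_cotangent_space n M A p. \<pi> p \<alpha> \<beta> = pairing \<beta> u)"
    and "v \<in> complex_tangent_space n M A p \<and>
           (\<forall>\<beta>\<in>complex_cotangent_space n M A p. \<pi> p \<alpha> \<beta> = pairing \<beta> v)"
  then show "u = v"
    by (intro pairing_separates[of u n M A p v]) auto
qed

lemma
  assumes "\<alpha> \<in> complex_cotangent_space n M A p"
  shows sharp_in: "sharp n M A \<pi> p \<alpha> \<in> complex_tangent_space n M A p"
    and pairing_sharp:
      "\<beta> \<in> complex_cotangent_space n M A p \<Longrightarrow> pairing \<beta> (sharp n M A \<pi> p \<alpha>) = \<pi> p \<alpha> \<beta>"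
  using theI'[OF sharp_exists_unique[OF assms]] unfolding sharp_def by auto

lemma sharp_eqI:
  assumes "\<alpha> \<in> complex_cotangent_space n M A p"
    and "v \<in> complex_tangent_space n M A p"
    and "\<And>\<beta>. \<beta> \<in> complex_cotangent_space n M A p \<Longrightarrow> \<pi> p \<alpha> \<beta> = pairing \<beta> v"
  shows "sharp n M A \<pi> p \<alpha> = v"
  unfolding sharp_def using assms by (intro the1_equality sharp_exists_unique) auto

text \<open>By skewness, \<pi>(\<gamma>, \<beta>) is minus the pairing of \<gamma> with the fixed
  vector \<open>sharp\<close> \<beta>, and the pairing is linear in the covector directly by its
  defining formula.\<close>

lemma bivector_lincomb_left:
  assumes "\<beta> \<in> complex_cotangent_space n M A p"
    and "\<alpha> \<in> complex_cotangent_space n M A p" "\<alpha>' \<in> complex_cotangent_space n M A p"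
    and "(\<lambda>X. a * \<alpha> X + b * \<alpha>' X) \<in> complex_cotangent_space n M A p"
  shows "\<pi> p (\<lambda>X. a * \<alpha> X + b * \<alpha>' X) \<beta> = a * \<pi> p \<alpha> \<beta> + b * \<pi> p \<alpha>' \<beta>"
proof -
  have *: "\<pi> p \<gamma> \<beta> = - pairing \<gamma> (sharp n M A \<pi> p \<beta>)"
    if "\<gamma> \<in> complex_cotangent_space n M A p" for \<gamma>
    using bivector_skew[OF P, of \<gamma> \<beta>] pairing_sharp[OF assms(1) that] by simp
  show ?thesis
    using assms(2-4) by (simp add: * pairing_def algebra_simps)
qed

text \<open>The witness is a \<alpha> + b \<beta>. Keeping both conclusions about one \<gamma>
  serves closure of E under combinations as well as linearity of the form.\<close>

lemma sharp_lincomb: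
  assumes \<alpha>: "\<alpha> \<in> complex_cotangent_space n M A p" and \<beta>: "\<beta> \<in> complex_cotangent_space n M A p"
  obtains \<gamma> where "\<gamma> \<in> complex_cotangent_space n M A p"
    and "sharp n M A \<pi> p \<gamma> = (\<lambda>f. a * sharp n M A \<pi> p \<alpha> f + b * sharp n M A \<pi> p \<beta> f)"
    and "\<And>\<delta>. \<delta> \<in> complex_cotangent_space n M A p \<Longrightarrow> \<pi> p \<gamma> \<delta> = a * \<pi> p \<alpha> \<delta> + b * \<pi> p \<beta> \<delta>"
proof
  let ?\<gamma> = "\<lambda>X. a * \<alpha> X + b * \<beta> X"
  let ?u = "\<lambda>f. a * sharp n M A \<pi> p \<alpha> f" and ?v = "\<lambda>f. b * sharp n M A \<pi> p \<beta> f"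
  show \<gamma>: "?\<gamma> \<in> complex_cotangent_space n M A p"
    using cfun.subspace_add[OF subspace_complex_cotangent_space
        cfun.subspace_scale[OF subspace_complex_cotangent_space \<alpha>, of a]
        cfun.subspace_scale[OF subspace_complex_cotangent_space \<beta>, of b]]
    by (simp add: plus_fun_def)
  show *: "\<pi> p ?\<gamma> \<delta> = a * \<pi> p \<alpha> \<delta> + b * \<pi> p \<beta> \<delta>"
    if "\<delta> \<in> complex_cotangent_space n M A p" for \<delta>
    by (rule bivector_lincomb_left[OF that \<alpha> \<beta> \<gamma>])
  have u: "?u \<in> complex_tangent_space n M A p" and v: "?v \<in> complex_tangent_space n M A p"
    by (intro cfun.subspace_scale[OF subspace_complex_tangent_space] sharp_in \<alpha> \<beta>)+
  \<comment> \<open>By uniqueness it is enough that \<open>?u + ?v\<close> pairs with every covector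
    as \<pi>(\<gamma>, -) does.\<close>
  have "sharp n M A \<pi> p ?\<gamma> = ?u + ?v"
  proof (rule sharp_eqI[OF \<gamma>])
    show "?u + ?v \<in> complex_tangent_space n M A p"
      by (rule cfun.subspace_add[OF subspace_complex_tangent_space u v])
    fix \<delta> assume \<delta>: "\<delta> \<in> complex_cotangent_space n M A p"
    show "\<pi> p ?\<gamma> \<delta> = pairing \<delta> (?u + ?v)"
      by (simp only: *[OF \<delta>] pairing_add_right[OF \<delta> u v] pairing_sharp[OF \<alpha> \<delta>]
          pairing_sharp[OF \<beta> \<delta>] pairing_scale_right[OF \<delta> sharp_in[OF \<alpha>]]
          pairing_scale_right[OF \<delta> sharp_in[OF \<beta>]])
  qed
  then show "sharp n M A \<pi> p ?\<gamma> = (\<lambda>f. ?u f + ?v f)"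
    by (simp add: plus_fun_def)
qed

section \<open>The image E as a finite-dimensional subspace\<close>

lemma subspace_sharp_image:
  "cfun.subspace (sharp_image n M A \<pi> p)"
proof -
  have lin: "(\<lambda>f. a * u f + b * v f) \<in> sharp_image n M A \<pi> p"
    if E: "u \<in> sharp_image n M A \<pi> p" "v \<in> sharp_image n M A \<pi> p" for u v a b
  proof -
    obtain \<alpha> \<beta> where C: "\<alpha> \<in> complex_cotangent_space n M A p" "\<beta> \<in> complex_cotangent_space n M A p"
      and s: "u = sharp n M A \<pi> p \<alpha>" "v = sharp n M A \<pi> p \<beta>"
      using E unfolding sharp_image_def by blast
    obtain \<gamma> where "\<gamma> \<in> complex_cotangent_space n M A p"
      and \<gamma>: "sharp n M A \<pi> p \<gamma> = (\<lambda>f. a * u f + b * v f)"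
      unfolding s by (rule sharp_lincomb[OF C])
    then show ?thesis
      unfolding sharp_image_def \<gamma>[symmetric] by blast
  qed
  \<comment> \<open>Some element of E is needed: the zero vector is then obtained as its combination
    with coefficients 0 and 0.\<close>
  have ne: "sharp n M A \<pi> p 0 \<in> sharp_image n M A \<pi> p"
    unfolding sharp_image_def by (intro imageI cfun.subspace_0 subspace_complex_cotangent_space)
  show ?thesis
  proof (rule cfun.subspaceI)
    show "0 \<in> sharp_image n M A \<pi> p"
      using lin[OF ne ne, of 0 0] by (simp add: zero_fun_def)
    show "u + v \<in> sharp_image n M A \<pi> p"
      if "u \<in> sharp_image n M A \<pi> p" "v \<in> sharp_image n M A \<pi> p" for u v
      using lin[OF that, of 1 1] by (simp add: plus_fun_def)
    show "(\<lambda>f. c * u f) \<in> sharp_image n M A \<pi> p"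
      if "u \<in> sharp_image n M A \<pi> p" for c u
      using lin[OF that that, of c 0] by simp
  qed
qed

lemma finite_span_sharp_image:
  "\<exists>B. finite B \<and> sharp_image n M A \<pi> p = cfun.span B"
proof -
  obtain B where B: "finite B" "B \<subseteq> complex_tangent_space n M A p"
    and *: "\<And>\<alpha>. \<alpha> \<in> complex_cotangent_space n M A p \<Longrightarrow>
       \<exists>v\<in>cfun.span B. \<forall>\<beta>\<in>complex_cotangent_space n M A p. \<pi> p \<alpha> \<beta> = pairing \<beta> v"
    by (rule bivector_contraction[OF P]) blast
  have span: "cfun.span B \<subseteq> complex_tangent_space n M A p"
    using B(2) by (intro cfun.span_minimal subspace_complex_tangent_space)
  \<comment> \<open>The contraction vector in the span of \<open>B\<close> represents
    \<pi>(\<alpha>, -), so by uniqueness it is \<open>sharp\<close> \<alpha>.\<close>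
  have "sharp n M A \<pi> p \<alpha> \<in> cfun.span B"
    if \<alpha>: "\<alpha> \<in> complex_cotangent_space n M A p" for \<alpha>
  proof -
    obtain v where v: "v \<in> cfun.span B"
      "\<And>\<beta>. \<beta> \<in> complex_cotangent_space n M A p \<Longrightarrow> \<pi> p \<alpha> \<beta> = pairing \<beta> v"
      using *[OF \<alpha>] by blast
    have "sharp n M A \<pi> p \<alpha> = v"
      by (rule sharp_eqI[OF \<alpha> subsetD[OF span v(1)] v(2)])
    then show ?thesis
      using v(1) by simp
  qed
  then have "sharp_image n M A \<pi> p \<subseteq> cfun.span B"
    unfolding sharp_image_def by auto
  then show ?thesis
    by (intro cfun.subspace_of_finite_span[OF _ B(1)] subspace_sharp_image)
qed

section \<open>The induced form on E\<close>

text \<open>Independence of the chosen preimages. The first slot enters only through its sharp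
  vector; skewness brings the second slot into first position, where the same argument
  applies.\<close>

lemma bivector_cong_sharp:
  assumes \<alpha>: "\<alpha> \<in> complex_cotangent_space n M A p" "\<alpha>' \<in> complex_cotangent_space n M A p"
    and \<beta>: "\<beta> \<in> complex_cotangent_space n M A p" "\<beta>' \<in> complex_cotangent_space n M A p"
    and eq: "sharp n M A \<pi> p \<alpha> = sharp n M A \<pi> p \<alpha>'" "sharp n M A \<pi> p \<beta> = sharp n M A \<pi> p \<beta>'"
  shows "\<pi> p \<alpha> \<beta> = \<pi> p \<alpha>' \<beta>'"
proof -
  have "\<pi> p \<alpha> \<beta> = \<pi> p \<alpha>' \<beta>"
    using pairing_sharp[OF \<alpha>(1) \<beta>(1)] pairing_sharp[OF \<alpha>(2) \<beta>(1)] eq(1) by simp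
  also have "\<dots> = - \<pi> p \<beta> \<alpha>'"
    by (rule bivector_skew[OF P])
  also have "\<dots> = - \<pi> p \<beta>' \<alpha>'"
    using pairing_sharp[OF \<beta>(1) \<alpha>(2)] pairing_sharp[OF \<beta>(2) \<alpha>(2)] eq(2) by simp
  also have "\<dots> = \<pi> p \<alpha>' \<beta>'"
    by (rule bivector_skew[OF P, symmetric])
  finally show ?thesis .
qed

lemma form_given_by_exists_unique:
  shows "\<exists>!\<Omega>. form_given_by n M A \<pi> p \<Omega>"
proof (rule ex_ex1I)
  let ?C = "complex_cotangent_space n M A p" and ?E = "sharp_image n M A \<pi> p"
  let ?s = "sharp n M A \<pi> p"
  \<comment> \<open>Arbitrary preimages under \<open>sharp\<close> are chosen; the value 0 off E is
    the one that \<open>form_given_by\<close> prescribes.\<close>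
  define \<Omega> where
    "\<Omega> u v = (if u \<in> ?E \<and> v \<in> ?E then \<pi> p (inv_into ?C ?s u) (inv_into ?C ?s v) else 0)" for u v
  have "\<Omega> (?s \<alpha>) (?s \<beta>) = \<pi> p \<alpha> \<beta>" if "\<alpha> \<in> ?C" "\<beta> \<in> ?C" for \<alpha> \<beta>
  proof -
    have E: "?s \<alpha> \<in> ?s ` ?C" "?s \<beta> \<in> ?s ` ?C"
      using that by auto
    have "\<pi> p (inv_into ?C ?s (?s \<alpha>)) (inv_into ?C ?s (?s \<beta>)) = \<pi> p \<alpha> \<beta>"
      using that by (intro bivector_cong_sharp inv_into_into E f_inv_into_f[OF E(1)] f_inv_into_f[OF E(2)])
    then show ?thesis
      using E by (simp add: \<Omega>_def sharp_image_def)
  qed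
  moreover have "\<forall>u v. u \<notin> ?E \<or> v \<notin> ?E \<longrightarrow> \<Omega> u v = 0"
    by (simp add: \<Omega>_def)
  ultimately have "form_given_by n M A \<pi> p \<Omega>"
    unfolding form_given_by_def by blast
  then show "\<exists>\<Omega>. form_given_by n M A \<pi> p \<Omega>"
    by (rule exI[of _ \<Omega>])
next
  fix \<Omega> \<Omega>' assume *: "form_given_by n M A \<pi> p \<Omega>" "form_given_by n M A \<pi> p \<Omega>'"
  \<comment> \<open>On E both forms are fixed by values of \<pi>, elsewhere both are 0, so they
    agree as total functions.\<close>
  have "\<Omega> u v = \<Omega>' u v" for u v
  proof (cases "u \<in> sharp_image n M A \<pi> p \<and> v \<in> sharp_image n M A \<pi> p")
    case True
    then show ?thesis
      using * unfolding form_given_by_def sharp_image_def by auto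
  next
    case False
    then show ?thesis
      using * unfolding form_given_by_def by metis
  qed
  then show "\<Omega> = \<Omega>'" by blast
qed

lemma complex_symplectic_space_sharp_image:
  assumes \<Omega>: "form_given_by n M A \<pi> p \<Omega>"
  shows "complex_symplectic_space (sharp_image n M A \<pi> p) \<Omega>"
proof -
  let ?C = "complex_cotangent_space n M A p" and ?E = "sharp_image n M A \<pi> p"
  let ?s = "sharp n M A \<pi> p"
  have form: "\<Omega> (?s \<alpha>) (?s \<beta>) = \<pi> p \<alpha> \<beta>" if "\<alpha> \<in> ?C" "\<beta> \<in> ?C" for \<alpha> \<beta>
    using \<Omega> that unfolding form_given_by_def by blast
  have skew: "\<Omega> u v = - \<Omega> v u" if "u \<in> ?E" "v \<in> ?E" for u v
  proof -
    obtain \<alpha> \<beta> where "\<alpha> \<in> ?C" "\<beta> \<in> ?C" "u = ?s \<alpha>" "v = ?s \<beta>"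
      using \<open>u \<in> ?E\<close> \<open>v \<in> ?E\<close> unfolding sharp_image_def by blast
    then show ?thesis
      using bivector_skew[OF P, of \<alpha> \<beta>] by (simp add: form)
  qed
  have left: "\<Omega> (\<lambda>x. a * u x + b * v x) w = a * \<Omega> u w + b * \<Omega> v w"
    if E: "u \<in> ?E" "v \<in> ?E" "w \<in> ?E" for u v w a b
  proof -
    obtain \<alpha> \<beta> \<delta> where C: "\<alpha> \<in> ?C" "\<beta> \<in> ?C" "\<delta> \<in> ?C"
      and s: "u = ?s \<alpha>" "v = ?s \<beta>" "w = ?s \<delta>"
      using E unfolding sharp_image_def by blast
    \<comment> \<open>The combination of vectors gets a single preimage \<gamma>, so the formula for
      \<Omega> applies to it.\<close>
    obtain \<gamma> where \<gamma>: "\<gamma> \<in> ?C" "?s \<gamma> = (\<lambda>x. a * ?s \<alpha> x + b * ?s \<beta> x)"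
      "\<And>\<delta>. \<delta> \<in> ?C \<Longrightarrow> \<pi> p \<gamma> \<delta> = a * \<pi> p \<alpha> \<delta> + b * \<pi> p \<beta> \<delta>"
      using sharp_lincomb[OF C(1,2)] by blast
    show ?thesis
      unfolding s \<gamma>(2)[symmetric] using C \<gamma>(1,3) by (simp add: form)
  qed
  have right: "\<Omega> w (\<lambda>x. a * u x + b * v x) = a * \<Omega> w u + b * \<Omega> w v"
    if E: "u \<in> ?E" "v \<in> ?E" "w \<in> ?E" for u v w a b
  proof -
    \<comment> \<open>Skewness is available only on E, so the combination must lie there before the
      slots are exchanged.\<close>
    have "(\<lambda>x. a * u x + b * v x) \<in> ?E"
      using cfun.subspace_add[OF subspace_sharp_image
          cfun.subspace_scale[OF subspace_sharp_image E(1), of a]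
          cfun.subspace_scale[OF subspace_sharp_image E(2), of b]]
      by (simp add: plus_fun_def)
    then show ?thesis
      using left[OF E, of a b] skew[of w] E by simp
  qed
  have nondeg: "u = 0" if u: "u \<in> ?E" and zero: "\<And>v. v \<in> ?E \<Longrightarrow> \<Omega> u v = 0" for u
  proof -
    obtain \<alpha> where \<alpha>: "\<alpha> \<in> ?C" "u = ?s \<alpha>"
      using u unfolding sharp_image_def by blast
    \<comment> \<open>Testing \<open>u\<close> against all \<open>?s\<close> \<beta> amounts to
      pairing it with all covectors \<beta>, and these separate it from 0.\<close>
    have "pairing \<beta> (?s \<alpha>) = pairing \<beta> 0" if "\<beta> \<in> ?C" for \<beta>
    proof -
      have "pairing \<beta> (?s \<alpha>) = \<Omega> u (?s \<beta>)"
        using pairing_sharp[OF \<alpha>(1) that] form[OF \<alpha>(1) that] \<alpha>(2) by simp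
      also have "\<dots> = 0"
        using that by (intro zero) (simp add: sharp_image_def)
      finally show ?thesis
        using pairing_zero_right[OF that] by simp
    qed
    then show ?thesis
      unfolding \<alpha>(2)
      by (rule pairing_separates[OF sharp_in[OF \<alpha>(1)]
            cfun.subspace_0[OF subspace_complex_tangent_space]])
  qed
  show ?thesis
    unfolding complex_symplectic_space_def
  proof (intro conjI ballI allI impI)
    fix u assume "u \<in> ?E" "\<forall>v\<in>?E. \<Omega> u v = 0"
    then show "u = 0"
      using nondeg by blast
  qed (rule subspace_sharp_image finite_span_sharp_image left right skew; assumption)+
qed

end

theorem proposition4p3:
  fixes n :: nat and M :: "'a topology" and A :: "'a chart set" and \<pi> :: "'a \<Rightarrow> 'a bivector"
  assumes "smooth_manifold n M A"
    and "complex_poisson_bivector n M A \<pi>"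
  shows "\<forall>p\<in>topspace M.
           (\<exists>!\<Omega>. form_given_by n M A \<pi> p \<Omega>) \<and>
           (\<forall>\<Omega>. form_given_by n M A \<pi> p \<Omega> \<longrightarrow>
                 complex_symplectic_space (sharp_image n M A \<pi> p) \<Omega>)"
proof
  fix p assume "p \<in> topspace M"
  \<comment> \<open>The claim is fibrewise: the field supplies at \<open>p\<close> a finite sum of
    wedges, to which the pointwise results apply.\<close>
  then interpret bivector_at n M A \<pi> p
    using assms(2)
    unfolding complex_poisson_bivector_def bivector_field_def by unfold_locales blast
  show "(\<exists>!\<Omega>. form_given_by n M A \<pi> p \<Omega>) \<and>
           (\<forall>\<Omega>. form_given_by n M A \<pi> p \<Omega> \<longrightarrow>
                 complex_symplectic_space (sharp_image n M A \<pi> p) \<Omega>)"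
    using form_given_by_exists_unique complex_symplectic_space_sharp_image by blast
qed

end
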